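(* Let $\mathbb{F}_q$ be a finite field with $q=p^r$ elements. For every integer $\ell$ with $\frac{q}{2}\le \ell<q-3$ there exists a multiset $M$ of $q$ elements of $\mathbb{F}_q$ with $\sum_{b\in M}b=0$, in which $0$ has multiplicity $\ell$ and $\ell$ is the highest multiplicity of any element of $M$, such that every polynomial $f\in\mathbb{F}_q[x]$ with range $M$ has degree greater than $\ell$.
   Context: The range of a polynomial $f\in\mathbb{F}_q[x]$ is the multiset $\{f(x): x\in\mathbb{F}_q\}$ of size $q$ (values counted with multiplicity). A polynomial has prescribed range $M$ if its range equals $M$ as a multiset. *)

theory Defs
  imports
    "HOL-Library.Multiset"
    "HOL-Library.Cardinality"
    "HOL-Computational_Algebra.Polynomial"
    "HOL-Computational_Algebra.Primes"
    Complex_Main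
begin

definition poly_range :: "'a::{field,finite} poly \<Rightarrow> 'a multiset" where
  "poly_range f = image_mset (poly f) (mset_set UNIV)"

end

theory Submission
  imports Defs
begin

text \<open>
  Let \<open>q = l + n + 2\<close>. Take \<open>M\<close> to consist of \<open>l\<close> zeros, \<open>n\<close> ones and two further nonzero
  values \<open>a\<close>, \<open>b\<close> with \<open>n + a + b = 0\<close>. If \<open>f\<close> has range \<open>M\<close> and degree at most \<open>l\<close>, then
  \<open>\<Sum>x. f(x) \<phi>(x) = 0\<close> for every polynomial \<open>\<phi>\<close> of degree at most \<open>n\<close>, because the \<open>j\<close>-th
  powers of all field elements sum to \<open>0\<close> for \<open>j < q - 1\<close>. Let \<open>f(u) = a\<close>, \<open>f(v) = b\<close>, and
  let \<open>A\<close> be the set of the \<open>n\<close> remaining points outside the zero set.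

  If \<open>p \<le> n\<close>, choose \<open>a\<close> outside the prime field. Comparing the relation for \<open>\<phi> = x\<^sup>p\<close> with the
  \<open>p\<close>-th power of the relation for \<open>\<phi> = x\<close> leaves \<open>(a\<^sup>p - a)(u\<^sup>p - v\<^sup>p) = 0\<close>, so \<open>u = v\<close>.

  If \<open>p > n\<close>, choose \<open>a = -1\<close>, \<open>b = -(n - 1)\<close>. The relations say that \<open>A\<close> and the multiset
  consisting of \<open>u\<close> and \<open>n - 1\<close> copies of \<open>v\<close> have equal power sums up to exponent \<open>n < p\<close>,
  which would make them equal, although \<open>v \<notin> A\<close>. Instead of Newton's identities, the proof uses
  the equivalent first-order differential equation for \<open>N = \<Prod>\<^bsub>s\<in>A\<^esub> (x - s)\<close>.
\<close>

section \<open>Power sums over a finite field\<close>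

lemma of_nat_CARD_eq_0: "of_nat CARD('a::{field,finite}) = (0::'a)"
proof -
  \<comment> \<open>Translation by 1 permutes the field.\<close>
  have "(\<Sum>x\<in>(UNIV::'a set). x) = (\<Sum>x\<in>(UNIV::'a set). x + 1)"
    by (rule sum.reindex_bij_witness[of _ "\<lambda>x. x + 1" "\<lambda>x. x - 1"]) auto
  then show ?thesis
    by (simp add: sum.distrib)
qed

text \<open>For j > 0, the polynomial x^j - 1 has at most j < q - 1 roots, so some nonzero a has a^j
  different from 1. Scaling by a permutes the field but multiplies the sum by a^j.\<close>

lemma sum_power_eq_0_finite_field:
  fixes j :: nat
  assumes "j < CARD('a::{field,finite}) - 1"
  shows "(\<Sum>x\<in>(UNIV::'a set). x ^ j) = 0"
proof (cases "j = 0")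
  case True
  then show ?thesis by (simp add: of_nat_CARD_eq_0)
next
  case False
  define P :: "'a poly" where "P = monom 1 j - 1"
  have deg: "degree P = j" and "P \<noteq> 0"
  proof -
    show "degree P = j"
      unfolding P_def using False
      by (subst diff_conv_add_uminus, subst degree_add_eq_left) (auto simp: degree_monom_eq)
    then show "P \<noteq> 0" using False by auto
  qed
  have "\<exists>a. a \<noteq> 0 \<and> a ^ j \<noteq> (1::'a)"
  proof (rule ccontr)
    assume "\<not> ?thesis"
    then have "UNIV - {0} \<subseteq> {x. poly P x = 0}"
      by (auto simp: P_def poly_monom)
    then have "card (UNIV - {0::'a}) \<le> card {x. poly P x = 0}"
      by (intro card_mono) auto
    also have "\<dots> \<le> j"
      using card_poly_roots_bound[OF \<open>P \<noteq> 0\<close>] deg by simp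
    finally show False using assms by (simp add: card_Diff_singleton)
  qed
  then obtain a :: 'a where a: "a \<noteq> 0" "a ^ j \<noteq> 1" by blast
  have "(\<Sum>x\<in>(UNIV::'a set). x ^ j) = (\<Sum>x\<in>UNIV. (a * x) ^ j)"
    by (rule sum.reindex_bij_witness[of _ "\<lambda>x. a * x" "\<lambda>x. x / a"]) (use a in auto)
  also have "\<dots> = a ^ j * (\<Sum>x\<in>UNIV. x ^ j)"
    by (simp add: power_mult_distrib sum_distrib_left)
  finally have "(1 - a ^ j) * (\<Sum>x\<in>(UNIV::'a set). x ^ j) = 0"
    by (simp add: algebra_simps)
  with a show ?thesis by simp
qed

lemma sum_poly_eq_0_finite_field:
  fixes P :: "'a::{field,finite} poly"
  assumes "degree P < CARD('a) - 1"
  shows "(\<Sum>x\<in>UNIV. poly P x) = 0"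
proof -
  have "(\<Sum>x\<in>UNIV. poly P x) = (\<Sum>i\<le>degree P. coeff P i * (\<Sum>x\<in>UNIV. x ^ i))"
    by (simp add: poly_altdef sum_distrib_left sum.swap[of _ UNIV])
  also have "\<dots> = 0"
    using assms by (intro sum.neutral) (auto simp: sum_power_eq_0_finite_field)
  finally show ?thesis .
qed

lemma CHAR_finite_field:
  assumes "prime p" and "CARD('a::{field,finite}) = p ^ r"
  shows "CHAR('a) = p"
proof -
  have "of_nat CARD('a) = (0::'a)"
    by (rule of_nat_CARD_eq_0)
  then have "CHAR('a) dvd p ^ r"
    unfolding of_nat_eq_0_iff_char_dvd assms(2) .
  moreover have "prime CHAR('a)"
    by (simp add: finite_imp_CHAR_pos prime_CHAR_semidom)
  ultimately show ?thesis
    using assms(1) prime_dvd_power primes_dvd_imp_eq by blast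
qed

section \<open>Points and linear relations determined by the range\<close>

lemma poly_range_decompose:
  fixes f :: "'a::{field,finite} poly"
  assumes "poly_range f = replicate_mset l 0 + replicate_mset n 1 + {#a, b#}"
  obtains u v A where "u \<noteq> v" "u \<notin> A" "v \<notin> A" "card A = n"
    "poly f u = a" "poly f v = b" "\<And>t. t \<in> A \<Longrightarrow> poly f t = 1"
    "\<And>t. t \<notin> A \<Longrightarrow> t \<noteq> u \<Longrightarrow> t \<noteq> v \<Longrightarrow> poly f t = 0"
proof -
  have "image_mset (poly f) (mset_set UNIV)
      = add_mset a (add_mset b (replicate_mset l 0 + replicate_mset n 1))"
    using assms by (simp add: poly_range_def)
  \<comment> \<open>Splitting off u and v as multiset preimages also covers coinciding values such
    as a = b.\<close>
  then obtain X u where X: "mset_set UNIV = add_mset u X" "poly f u = a"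
      "image_mset (poly f) X = add_mset b (replicate_mset l 0 + replicate_mset n 1)"
    by (metis msed_map_invR)
  then obtain Y v where Y: "X = add_mset v Y" "poly f v = b"
      "image_mset (poly f) Y = replicate_mset l 0 + replicate_mset n 1"
    by (metis msed_map_invR)
  have cnt: "count (mset_set UNIV) x = 1" for x :: 'a
    by simp
  have uv: "u \<noteq> v"
  proof
    assume "u = v"
    then have "count (mset_set UNIV) u \<ge> 2" using X Y by simp
    then show False using cnt[of u] by linarith
  qed
  have Yeq: "Y = mset_set (UNIV - {u, v})"
  proof (rule multiset_eqI)
    fix x
    show "count Y x = count (mset_set (UNIV - {u, v})) x"
      using cnt[of x] uv unfolding X(1) Y(1) by (auto split: if_splits)
  qed
  define A where "A = {x \<in> UNIV - {u, v}. poly f x = 1}"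
  have "filter_mset (\<lambda>y. y = 1) (image_mset (poly f) Y) = replicate_mset n 1"
    unfolding Y(3) by (auto simp: multiset_eq_iff)
  then have "size (filter_mset (\<lambda>x. poly f x = 1) Y) = n"
    unfolding filter_mset_image_mset by (metis size_image_mset size_replicate_mset)
  then have cardA: "card A = n"
    by (simp add: Yeq A_def)
  have A0: "poly f t = 0" if "t \<notin> A" "t \<noteq> u" "t \<noteq> v" for t
  proof -
    have "poly f t \<in># image_mset (poly f) Y"
      using that by (auto simp: Yeq)
    then show ?thesis
      using that unfolding Y(3) by (auto simp: A_def split: if_splits)
  qed
  show ?thesis
    by (rule that[OF uv _ _ cardA X(2) Y(2) _ A0]) (auto simp: A_def)
qed

lemma poly_range_sum_eq_0:
  fixes f \<phi> :: "'a::{field,finite} poly"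
  assumes "u \<noteq> v" "u \<notin> A" "v \<notin> A" "\<And>t. t \<in> A \<Longrightarrow> poly f t = 1"
    "\<And>t. t \<notin> A \<Longrightarrow> t \<noteq> u \<Longrightarrow> t \<noteq> v \<Longrightarrow> poly f t = 0"
    and "degree f + degree \<phi> + 1 < CARD('a)"
  shows "(\<Sum>t\<in>A. poly \<phi> t) + poly f u * poly \<phi> u + poly f v * poly \<phi> v = 0"
proof -
  have "0 = (\<Sum>x\<in>UNIV. poly (f * \<phi>) x)"
    using assms(6) degree_mult_le[of f \<phi>]
    by (intro sum_poly_eq_0_finite_field[symmetric]) linarith
  also have "\<dots> = (\<Sum>x\<in>insert u (insert v A). poly (f * \<phi>) x)"
    using assms(5) by (intro sum.mono_neutral_right) auto
  also have "\<dots> = poly f u * poly \<phi> u + (poly f v * poly \<phi> v + (\<Sum>t\<in>A. poly f t * poly \<phi> t))"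
    using assms(1-3) by simp
  also have "(\<Sum>t\<in>A. poly f t * poly \<phi> t) = (\<Sum>t\<in>A. poly \<phi> t)"
    using assms(4) by (intro sum.cong) auto
  finally show ?thesis by (simp add: algebra_simps)
qed

section \<open>The case p \<le> n\<close>

lemma of_nat_power_CHAR:
  assumes "prime p" "CHAR('a::idom) = p"
  shows "of_nat k ^ p = (of_nat k :: 'a)"
proof (induction k)
  case 0
  then show ?case using prime_gt_0_nat[OF assms(1)] by simp
next
  case (Suc k)
  have "(1 + of_nat k :: 'a) ^ p = 1 ^ p + of_nat k ^ p"
    using assms by (intro freshmans_dream) auto
  with Suc show ?case by simp
qed

lemma degree_bound_if_value_outside_prime_field:
  fixes f :: "'a::{field,finite} poly"
  assumes p: "prime p" "CHAR('a) = p" "p \<le> n"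
    and a: "a ^ p \<noteq> a"
    and range: "poly_range f = replicate_mset l 0 + replicate_mset n 1 + {#a, - of_nat n - a#}"
  shows "CARD('a) < degree f + n + 2"
proof (rule ccontr)
  assume "\<not> ?thesis"
  then have deg: "degree f + n + 1 < CARD('a)" by simp
  from range obtain u v A where uvA: "u \<noteq> v" "u \<notin> A" "v \<notin> A" "card A = n"
    "poly f u = a" "poly f v = - of_nat n - a" "\<And>t. t \<in> A \<Longrightarrow> poly f t = 1"
    "\<And>t. t \<notin> A \<Longrightarrow> t \<noteq> u \<Longrightarrow> t \<noteq> v \<Longrightarrow> poly f t = 0"
    by (rule poly_range_decompose) blast
  define b where "b = - of_nat n - a"
  have S: "(\<Sum>t\<in>A. t ^ k) + a * u ^ k + b * v ^ k = 0" if "k \<le> n" for k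
    using poly_range_sum_eq_0[OF uvA(1-3,7,8), of "monom 1 k"] deg that uvA(5,6)
    by (simp add: degree_monom_eq poly_monom b_def)
  have fd: "(x + y) ^ p = x ^ p + y ^ p" for x y :: 'a
    using p by (intro freshmans_dream) auto
  have fm: "(- x) ^ p = - (x ^ p)" for x :: 'a
    using p by (intro minus_power_prime_CHAR) auto
  have p0: "p > 0" using p prime_gt_0_nat by blast
  have fsum: "(\<Sum>t\<in>A. t) ^ p = (\<Sum>t\<in>A. t ^ p)"
    using p0 by (induction A rule: infinite_finite_induct) (simp_all add: fd)
  have "((\<Sum>t\<in>A. t) + a * u + b * v) ^ p = 0"
    using S[of 1] p p0 by simp
  then have "(\<Sum>t\<in>A. t ^ p) + a ^ p * u ^ p + b ^ p * v ^ p = 0"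
    by (simp add: fd fsum power_mult_distrib)
  moreover have "b ^ p = - of_nat n - a ^ p"
    using fd[of "- of_nat n" "- a"] by (simp add: b_def fm of_nat_power_CHAR p)
  moreover have "(\<Sum>t\<in>A. t ^ p) + a * u ^ p + (- of_nat n - a) * v ^ p = 0"
    using S p(3) unfolding b_def by blast
  \<comment> \<open>The primed letters stand for p-th powers; subtracting the two relations cancels
    s and both terms in c.\<close>
  moreover have "(a' - a) * (u' - v') = 0"
    if "s + a' * u' + b' * v' = 0" "b' = - c - a'" "s + a * u' + (- c - a) * v' = 0"
    for s a' u' b' v' c :: 'a
    using that by algebra
  ultimately have "(a ^ p - a) * (u ^ p - v ^ p) = 0"
    by blast
  with a have "u ^ p - v ^ p = 0" by simp
  then have "(u - v) ^ p = 0"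
    using fd[of u "- v"] by (simp add: fm)
  with uvA(1) p0 show False by simp
qed

section \<open>The case p > n\<close>

text \<open>Above the constant term the equation is a two-term recurrence. Its right-hand factor i +
  2 - n vanishes at i = n - 2, so that coefficient is 0. Going down from there, all lower
  coefficients vanish because n - i is invertible.\<close>

lemma coeff_0_eq_0_if_ode:
  fixes N :: "'a::field poly"
  assumes ode: "pderiv N * ([:- w, 1:] * [:0, 1:]) - N * [:0, 1:]
      - smult (of_nat (n - 1)) (N * [:- w, 1:]) = [:c:]"
    and n: "n \<ge> 2" "\<And>k. 1 \<le> k \<Longrightarrow> k \<le> n \<Longrightarrow> of_nat k \<noteq> (0::'a)"
  shows "coeff N 0 = 0"
proof -
  have rec: "(of_nat i - of_nat n) * coeff N i
      = w * (of_nat i + 2 - of_nat n) * coeff N (Suc i)" for i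
  proof -
    have "coeff (pderiv N * ([:- w, 1:] * [:0, 1:]) - N * [:0, 1:]
      - smult (of_nat (n - 1)) (N * [:- w, 1:])) (Suc i) = 0"
      unfolding ode by simp
    moreover have "of_nat (n - 1) = (of_nat n - 1 :: 'a)"
      using n(1) by (simp add: of_nat_diff)
    ultimately have "coeff (pderiv N * ([:- w, 1:] * [:0, 1:]) - N * [:0, 1:]
      - smult (of_nat n - 1) (N * [:- w, 1:])) (Suc i) = 0"
      by simp
    then show ?thesis
      by (cases i) (simp_all add: coeff_pCons coeff_pderiv algebra_simps)
  qed
  have "coeff N (n - 2 - j) = 0" if "j \<le> n - 2" for j
    using that
  proof (induction j)
    case 0
    have "(of_nat (n - 2) - of_nat n :: 'a) = - of_nat 2"
      "(of_nat (n - 2) + 2 - of_nat n :: 'a) = 0"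
      using n(1) by (simp_all add: of_nat_diff)
    then show ?case
      using rec[of "n - 2"] n(1) n(2)[of 2] by simp
  next
    case (Suc j)
    define i where "i = n - 2 - Suc j"
    have i: "Suc i = n - 2 - j" "i \<le> n" using Suc.prems by (auto simp: i_def)
    have "(of_nat i - of_nat n) * coeff N i = 0"
      using rec[of i] Suc i by simp
    moreover have "(of_nat i - of_nat n :: 'a) = - of_nat (n - i)"
      using i by (simp add: of_nat_diff)
    moreover have "of_nat (n - i) \<noteq> (0::'a)"
      using Suc.prems by (intro n(2)) (auto simp: i_def)
    ultimately show ?case by (simp add: i_def)
  qed
  from this[of "n - 2"] show ?thesis by simp
qed

lemma poly_pderiv_prod_linear:
  fixes A :: "'a::field set"
  assumes "finite A" "t \<in> A"
  shows "poly (pderiv (\<Prod>s\<in>A. [:- s, 1:])) t = (\<Prod>s\<in>A - {t}. t - s)"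
proof -
  have "(\<Prod>s\<in>A. [:- s, 1:]) = [:- t, 1:] * (\<Prod>s\<in>A - {t}. [:- s, 1:])"
    using assms by (rule prod.remove)
  then show ?thesis
    by (simp add: pderiv_mult pderiv_pCons poly_prod del: mult_pCons_left)
qed

lemma degree_bound_if_less_CHAR:
  fixes f :: "'a::{field,finite} poly"
  assumes n: "n \<ge> 2" "\<And>k. 1 \<le> k \<Longrightarrow> k \<le> n \<Longrightarrow> of_nat k \<noteq> (0::'a)"
    and range: "poly_range f = replicate_mset l 0 + replicate_mset n 1 + {#- 1, - of_nat (n - 1)#}"
  shows "CARD('a) < degree f + n + 2"
proof (rule ccontr)
  assume "\<not> ?thesis"
  then have deg: "degree f + n + 1 < CARD('a)" by simp
  from range obtain u v A where uvA: "u \<noteq> v" "u \<notin> A" "v \<notin> A" "card A = n"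
    "poly f u = - 1" "poly f v = - of_nat (n - 1)" "\<And>t. t \<in> A \<Longrightarrow> poly f t = 1"
    "\<And>t. t \<notin> A \<Longrightarrow> t \<noteq> u \<Longrightarrow> t \<noteq> v \<Longrightarrow> poly f t = 0"
    by (rule poly_range_decompose) blast
  define T where "T = insert u (insert v A)"
  have cardT: "card T = n + 2"
    using uvA(1-4) by (simp add: T_def)
  \<comment> \<open>Since \<open>\<Sum>\<^bsub>T\<^esub> f \<phi>\<close> vanishes for \<open>\<phi> = \<Prod>\<^bsub>w \<in> T - {s, t}\<^esub> (x - w)\<close>, the function \<open>G\<close> is constant on \<open>T\<close>.\<close>
  define G where "G s = poly f s * (\<Prod>w\<in>T - {s}. s - w)" for s
  have G_eq: "G s = G t" if st: "s \<in> T" "t \<in> T" "s \<noteq> t" for s t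
  proof -
    define \<phi> where "\<phi> = (\<Prod>w\<in>T - {s, t}. [:- w, 1:])"
    have "degree \<phi> = n"
      using st cardT by (simp add: \<phi>_def degree_prod_eq_sum_degree card_Diff_subset)
    then have "0 = (\<Sum>x\<in>UNIV. poly (f * \<phi>) x)"
      using deg degree_mult_le[of f \<phi>]
      by (intro sum_poly_eq_0_finite_field[symmetric]) linarith
    also have "\<dots> = (\<Sum>x\<in>{s, t}. poly (f * \<phi>) x)"
    proof (intro sum.mono_neutral_right ballI)
      fix x assume x: "x \<in> UNIV - {s, t}"
      show "poly (f * \<phi>) x = 0"
      proof (cases "x \<in> T")
        case True
        with x show ?thesis by (auto simp: \<phi>_def poly_prod)
      next
        case False
        then show ?thesis using uvA(8)[of x] by (auto simp: T_def)
      qed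
    qed auto
    finally have *: "poly f s * poly \<phi> s + poly f t * poly \<phi> t = 0"
      using st by simp
    have "T - {s} = insert t (T - {s, t})" "T - {t} = insert s (T - {s, t})"
      using st by auto
    then have "G s = poly f s * ((s - t) * poly \<phi> s)" "G t = poly f t * ((t - s) * poly \<phi> t)"
      by (simp_all add: G_def \<phi>_def poly_prod)
    then have "G s - G t = (s - t) * (poly f s * poly \<phi> s + poly f t * poly \<phi> t)"
      by algebra
    with * show ?thesis by simp
  qed
  define N where "N = (\<Prod>s\<in>A. [:- s, 1:])"
  have degN: "degree N = n"
    using uvA(4) by (simp add: N_def degree_prod_eq_sum_degree)
  \<comment> \<open>\<open>R = \<Sum>\<^bsub>t \<in> T\<^esub> f(t) \<Prod>\<^bsub>w \<in> T - {t}\<^esub> (x - w)\<close> interpolates \<open>G\<close> on \<open>T\<close> and has degree less than \<open>|T|\<close>.\<close>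
  define R where "R = pderiv N * ([:- u, 1:] * [:- v, 1:]) - N * [:- v, 1:]
      - smult (of_nat (n - 1)) (N * [:- u, 1:])"
  have RG: "poly R s = G s" if "s \<in> T" for s
  proof -
    consider "s = u" | "s = v" | "s \<in> A" using \<open>s \<in> T\<close> by (auto simp: T_def)
    then show ?thesis
    proof cases
      case 1
      have "T - {u} = insert v A" using uvA by (auto simp: T_def)
      then show ?thesis using 1 uvA
        by (simp add: R_def G_def N_def poly_prod algebra_simps)
    next
      case 2
      have "T - {v} = insert u A" using uvA by (auto simp: T_def)
      then show ?thesis using 2 uvA
        by (simp add: R_def G_def N_def poly_prod algebra_simps)
    next
      case 3
      have "T - {s} = insert u (insert v (A - {s}))" using 3 uvA by (auto simp: T_def)
      moreover have "poly N s = 0" using 3 by (auto simp: N_def poly_prod)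
      moreover have "poly (pderiv N) s = (\<Prod>w\<in>A - {s}. s - w)"
        unfolding N_def using 3 by (intro poly_pderiv_prod_linear) auto
      ultimately show ?thesis using 3 uvA
        by (simp add: R_def G_def algebra_simps)
    qed
  qed
  have degR: "degree R \<le> n + 1"
  proof -
    have "degree (pderiv N) \<le> n - 1"
      using degN by (intro degree_le) (auto simp: coeff_pderiv coeff_eq_0)
    then have "degree (pderiv N * ([:- u, 1:] * [:- v, 1:])) \<le> n + 1"
      using degree_mult_le[of "pderiv N" "[:- u, 1:] * [:- v, 1:]"]
        degree_mult_le[of "[:- u, 1:]" "[:- v, 1:]"] n(1) by simp
    moreover have "degree (N * [:- v, 1:]) \<le> n + 1"
      using degree_mult_le[of N "[:- v, 1:]"] degN by simp
    moreover have "degree (smult (of_nat (n - 1)) (N * [:- u, 1:])) \<le> n + 1"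
      using degree_mult_le[of N "[:- u, 1:]"] degN
        degree_smult_le[of "of_nat (n - 1)" "N * [:- u, 1:]"] by simp
    ultimately show ?thesis
      unfolding R_def by (intro degree_diff_le)
  qed
  \<comment> \<open>Both sides have degree at most n + 1 and agree on the n + 2 points of
    \<open>T\<close>.\<close>
  have R: "R = [:G v:]"
  proof (rule poly_eqI_degree)
    fix s assume s: "s \<in> T"
    have "G s = G v" using G_eq[OF s, of v] by (cases "s = v") (auto simp: T_def)
    then show "poly R s = poly [:G v:] s" using RG[OF s] by simp
  qed (use degR cardT in auto)
  \<comment> \<open>Moving v to the origin gives the equation of \<open>coeff_0_eq_0_if_ode\<close>
    with w = u - v, and turns N(v) into a constant coefficient.\<close>
  define sh where "sh = [:v, 1:]"
  define N' where "N' = pcompose N sh"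
  have "pderiv N' = pcompose (pderiv N) sh"
    by (simp add: N'_def pderiv_pcompose sh_def pderiv_pCons)
  moreover have "pcompose [:- u, 1:] sh = [:- (u - v), 1:]" "pcompose [:- v, 1:] sh = [:0, 1:]"
    by (simp_all add: pcompose_pCons sh_def)
  moreover have "pcompose R sh = [:G v:]"
    by (simp add: R)
  ultimately have "pderiv N' * ([:- (u - v), 1:] * [:0, 1:]) - N' * [:0, 1:]
      - smult (of_nat (n - 1)) (N' * [:- (u - v), 1:]) = [:G v:]"
    unfolding R_def pcompose_diff pcompose_mult pcompose_smult N'_def by simp
  then have "coeff N' 0 = 0"
    using n by (rule coeff_0_eq_0_if_ode)
  then have "poly N v = 0"
    by (simp add: N'_def poly_0_coeff_0[symmetric] poly_pcompose sh_def)
  then show False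
    using uvA(3) by (auto simp: N_def poly_prod)
qed

section \<open>Choice of the multiset\<close>

theorem theorem3:
  fixes p r q l :: nat
  assumes "prime p"
    and "q = p ^ r"
    and "CARD('a::{field,finite}) = q"
    and "real q / 2 \<le> real l"
    and "real l < real q - 3"
  shows "\<exists>M :: 'a multiset.
           size M = q \<and>
           (\<Sum>b\<in>#M. b) = 0 \<and>
           count M 0 = l \<and>
           (\<forall>b. count M b \<le> l) \<and>
           (\<forall>f :: 'a poly. poly_range f = M \<longrightarrow> degree f > l)"
proof -
  have char: "CHAR('a) = p"
    using assms(1-3) by (intro CHAR_finite_field[of p r]) auto
  define n where "n = q - l - 2"
  \<comment> \<open>The bound n + 2 \<le> l keeps every nonzero multiplicity at most l, even if some
    of 1, a, b coincide.\<close>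
  have l: "q = l + n + 2" "n \<ge> 2" "n + 2 \<le> l"
    using assms(4,5) by (auto simp: n_def)
  have witness: ?thesis
    if ab: "a \<noteq> 0" "b \<noteq> 0" "of_nat n + (a + b) = 0"
      and deg: "\<And>f :: 'a poly. poly_range f = replicate_mset l 0 + replicate_mset n 1 + {#a, b#}
        \<Longrightarrow> CARD('a) < degree f + n + 2" for a b :: 'a
  proof (intro exI conjI allI impI)
    let ?M = "replicate_mset l 0 + replicate_mset n 1 + {#a, b#}"
    show "size ?M = q" using l by simp
    show "(\<Sum>b\<in>#?M. b) = 0" using ab(3) by (simp add: algebra_simps)
    show "count ?M 0 = l" using ab by simp
    show "count ?M x \<le> l" for x
      using ab l by (cases "x = 0") auto
    show "degree f > l" if "poly_range f = ?M" for f
      using deg[OF that] l assms(3) by simp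
  qed
  show ?thesis
  proof (cases "p \<le> n")
    case True
    have p: "p > 1" using assms(1) prime_gt_1_nat by blast
    define P :: "'a poly" where "P = monom 1 p - [:0, 1:]"
    have degP: "degree P = p"
      unfolding P_def using p
      by (subst diff_conv_add_uminus, subst degree_add_eq_left) (auto simp: degree_monom_eq)
    then have "P \<noteq> 0" using p by auto
    \<comment> \<open>\<open>P\<close> has at most p \<le> n < q roots.\<close>
    have "\<exists>a::'a. a ^ p \<noteq> a"
    proof (rule ccontr)
      assume "\<not> ?thesis"
      then have "{x. poly P x = 0} = UNIV"
        by (auto simp: P_def poly_monom)
      then show False
        using card_poly_roots_bound[OF \<open>P \<noteq> 0\<close>] degP True l assms(3) by simp
    qed
    then obtain a :: 'a where a: "a ^ p \<noteq> a" by blast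
    show ?thesis
    proof (rule witness[of a "- of_nat n - a"])
      show "a \<noteq> 0" using a p by auto
      \<comment> \<open>Otherwise a = -n would lie in the prime field, which the p-th power map
        fixes.\<close>
      show "- of_nat n - a \<noteq> 0"
      proof
        assume "- of_nat n - a = 0"
        then have "a = - of_nat n" by (simp add: algebra_simps)
        moreover have "(- of_nat n :: 'a) ^ p = - (of_nat n ^ p)"
          using assms(1) char by (intro minus_power_prime_CHAR) auto
        ultimately show False
          using a of_nat_power_CHAR[OF assms(1) char] by simp
      qed
    qed (simp, rule degree_bound_if_value_outside_prime_field[OF assms(1) char True a])
  next
    case False
    have nz: "of_nat k \<noteq> (0::'a)" if "1 \<le> k" "k \<le> n" for k
      using that False char by (auto simp: of_nat_eq_0_iff_char_dvd dest: dvd_imp_le)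
    show ?thesis
    \<comment> \<open>The value -(n - 1) at v makes the recurrence in
      \<open>coeff_0_eq_0_if_ode\<close> break off at index n - 2.\<close>
    proof (rule witness[of "- 1" "- of_nat (n - 1)"])
      show "- of_nat (n - 1) \<noteq> (0::'a)" using nz[of "n - 1"] l by simp
      show "of_nat n + (- 1 + - of_nat (n - 1)) = (0::'a)"
        using l by (simp add: of_nat_diff)
      show "CARD('a) < degree f + n + 2"
        if "poly_range f = replicate_mset l 0 + replicate_mset n 1 + {#- 1, - of_nat (n - 1)#}"
        for f :: "'a poly"
        using l(2) nz that by (rule degree_bound_if_less_CHAR)
    qed simp
  qed
qed

end
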